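(* There is a universal constant $C>0$ such that for every $N\ge 1$ and every complex univariate polynomial $P$ of degree $N$, \[ \mu_{\rm norm}(P)\ge C\sqrt{N}. \]
   Context: For a complex univariate polynomial $P(z)=\sum_{i=0}^N a_i z^i$ of degree $N$, the Weyl norm is $\|P\|=\left(\sum_{i=0}^N\binom{N}{i}^{-1}|a_i|^2\right)^{1/2}$. The normalized condition number of $P$ at a zero $z\in\mathbb{C}$ is \[ \mu_{\rm norm}(P,z)=N^{1/2}\,\frac{\|P\|\,(1+|z|^2)^{N/2-1}}{|P'(z)|}, \] with $\mu_{\rm norm}(P,z)=\infty$ if $P'(z)=0$ (i.e. $z$ is a multiple zero), and the normalized condition number of $P$ is $\mu_{\rm norm}(P)=\max_{z\in\mathbb{C}:P(z)=0}\mu_{\rm norm}(P,z)$. *)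

theory Defs
  imports
    "HOL-Analysis.Analysis"
    "HOL-Computational_Algebra.Polynomial"
    "HOL-Library.Extended_Real"
begin

definition weyl_norm :: "complex poly \<Rightarrow> real" where
  "weyl_norm P =
     sqrt (\<Sum>i\<le>degree P. inverse (real (degree P choose i)) * (cmod (coeff P i))\<^sup>2)"

definition mu_norm_at :: "complex poly \<Rightarrow> complex \<Rightarrow> ereal" where
  "mu_norm_at P z =
     (if poly (pderiv P) z = 0 then \<infinity>
      else ereal (sqrt (real (degree P)) *
                  (weyl_norm P * (1 + (cmod z)\<^sup>2) powr (real (degree P) / 2 - 1)
                     / cmod (poly (pderiv P) z))))"

text \<open>Intended for \<open>P\<close> of positive degree, where the zero set is finite and nonempty;
  for a nonzero constant \<open>P\<close> this is the unspecified maximum of the empty set.\<close>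

definition mu_norm :: "complex poly \<Rightarrow> ereal" where
  "mu_norm P = Max (mu_norm_at P ` {z. poly P z = 0})"

end

theory Submission
  imports
    Defs
    "Jordan_Normal_Form.Schur_Decomposition"
    "Berlekamp_Zassenhaus.Mahler_Measure"
    "HOL-Real_Asymp.Real_Asymp"
begin

text \<open>
  Put the zeros \<open>z\<^sub>0, \<dots>, z\<^sub>n\<^sub>-\<^sub>1\<close> of \<open>P = c (z - z\<^sub>0) \<cdots> (z - z\<^sub>n\<^sub>-\<^sub>1)\<close> on the Riemann sphere, where half the chordal
  distance of two of them is \<open>[i,j] = \<bar>z\<^sub>i - z\<^sub>j\<bar> / sqrt (s\<^sub>i s\<^sub>j)\<close> with \<open>s\<^sub>i = 1 + \<bar>z\<^sub>i\<bar>\<^sup>2\<close>. Since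
  \<open>P'(z\<^sub>i)\<close> is \<open>c\<close> times the product of the other differences, all powers of \<open>s\<^sub>i\<close> cancel and the
  condition number at \<open>z\<^sub>i\<close> becomes
  \<open>sqrt n * R / (\<Prod>j\<noteq>i. [i,j])\<close> with \<open>R = weyl_norm P / (\<bar>c\<bar> * sqrt (\<Prod>j. s\<^sub>j))\<close>.
  Two estimates, both sharp up to a constant factor, give the theorem.

  No configuration of points is too spread out: some \<open>i\<close> satisfies
  \<open>(\<Prod>j\<noteq>i. [i,j]) \<le> exp (3/2) * sqrt n * exp (- n/2)\<close> (\<open>ex_small_root_product\<close>). The product over all
  \<open>i\<close> of the left-hand side is the square of a Vandermonde determinant in which row \<open>i\<close> is scaled
  by a power of \<open>s\<^sub>i\<close>. If column \<open>k\<close> is scaled by the square root of \<open>n-1 choose k\<close>, the binomial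
  theorem makes every row a unit vector, so that Hadamard's inequality (\<open>hadamard_det_le_1\<close>) bounds
  the determinant by 1. What remains is the size of the product of the binomial coefficients of a
  row of Pascal's triangle (\<open>ln_prod_binomial_ge\<close>).

  Conversely \<open>R\<^sup>2 \<ge> (n+1) * exp (- n)\<close> (\<open>weyl_norm_ge\<close>). By the beta integral, the squared Weyl norm
  is \<open>n+1\<close> times the mean of \<open>\<bar>P(w)\<bar>\<^sup>2 / (1 + \<bar>w\<bar>\<^sup>2)\<^sup>n\<close> over the sphere. On each circle of latitude
  Landau's inequality replaces \<open>\<bar>P\<bar>\<^sup>2\<close> by its geometric mean, and Jensen's inequality does the same
  for the remaining average over the latitudes. The geometric mean of the squared half chordal
  distance to a fixed point is \<open>exp (- 1)\<close>, wherever that point lies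
  (\<open>has_integral_ln_latitude_mean\<close>).

  For the index \<open>i\<close> of the first estimate the exponentials cancel, and the condition number at
  \<open>z\<^sub>i\<close> is at least \<open>exp (- 3/2) * sqrt n\<close>.
\<close>

hide_const (open) up_ring.coeff module.smult

section \<open>Hadamard's inequality\<close>

lemma trace_mult_commute:
  assumes "X \<in> carrier_mat n m" "Y \<in> carrier_mat m n"
  shows "(\<Sum>i<n. (X * Y) $$ (i,i)) = (\<Sum>j<m. (Y * X) $$ (j,j) :: 'a :: comm_ring_1)"
proof -
  have "(\<Sum>i<n. (X * Y) $$ (i,i)) = (\<Sum>i<n. \<Sum>j<m. X $$ (i,j) * Y $$ (j,i))"
    using assms by (intro sum.cong) (auto simp: scalar_prod_def atLeast0LessThan)
  also have "\<dots> = (\<Sum>j<m. \<Sum>i<n. Y $$ (j,i) * X $$ (i,j))"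
    by (subst sum.swap) (simp add: mult.commute)
  also have "\<dots> = (\<Sum>j<m. (Y * X) $$ (j,j))"
    using assms by (intro sum.cong) (auto simp: scalar_prod_def atLeast0LessThan)
  finally show ?thesis .
qed

lemma trace_similar_mat_wit:
  assumes "similar_mat_wit A B P Q" and A: "A \<in> carrier_mat n n"
  shows "(\<Sum>i<n. A $$ (i,i)) = (\<Sum>i<n. B $$ (i,i) :: 'a :: comm_ring_1)"
proof -
  note D = similar_mat_witD2[OF A assms(1)]
  have "(\<Sum>i<n. A $$ (i,i)) = (\<Sum>i<n. (P * (B * Q)) $$ (i,i))"
    using D by (simp add: assoc_mult_mat[of _ n n _ n _ n])
  also have "\<dots> = (\<Sum>i<n. ((B * Q) * P) $$ (i,i))"
    by (rule trace_mult_commute[of _ n n]) (use D in auto)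
  also have "(B * Q) * P = B"
    using D by (simp add: assoc_mult_mat[of _ n n _ n _ n])
  finally show ?thesis .
qed

text \<open>
  If \<open>v\<close> is an eigenvector and \<open>w\<close> is the image of \<open>v\<close> under the adjoint of \<open>A\<close>, then
  \<open>\<parallel>w\<parallel>\<^sup>2 = e * \<parallel>v\<parallel>\<^sup>2\<close>.
\<close>

lemma eigenvalue_mult_adjoint:
  fixes A :: "complex mat"
  assumes A: "A \<in> carrier_mat n n"
    and "eigenvalue (A * transpose_mat (map_mat cnj A)) e"
  shows "e = complex_of_real (Re e)" "Re e \<ge> 0"
proof -
  define H where "H = transpose_mat (map_mat cnj A)"
  have H: "H \<in> carrier_mat n n" using A by (simp add: H_def)
  from assms obtain v where v: "v \<in> carrier_vec n" "v \<noteq> 0\<^sub>v n" "(A * H) *\<^sub>v v = e \<cdot>\<^sub>v v"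
    by (auto simp: eigenvalue_def eigenvector_def H_def)
  define w where "w = H *\<^sub>v v"
  have w: "w \<in> carrier_vec n" using H v by (auto simp: w_def)
  have Aw: "A *\<^sub>v w = e \<cdot>\<^sub>v v"
    using v assoc_mult_mat_vec[OF A H v(1)] by (simp add: w_def)
  have Aw_i: "(\<Sum>j<n. A $$ (i,j) * w $ j) = e * v $ i" if "i < n" for i
    using arg_cong[OF Aw, of "\<lambda>x. x $ i"] that A v w
    by (simp add: scalar_prod_def atLeast0LessThan)
  have w_j: "w $ j = (\<Sum>i<n. cnj (A $$ (i,j)) * v $ i)" if "j < n" for j
    using that A v by (simp add: w_def H_def scalar_prod_def atLeast0LessThan)
  have "(\<Sum>j<n. w $ j * cnj (w $ j)) = (\<Sum>j<n. \<Sum>i<n. cnj (v $ i) * (A $$ (i,j) * w $ j))"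
    by (intro sum.cong refl, subst (2) w_j) (auto simp: sum_distrib_left mult_ac)
  also have "\<dots> = (\<Sum>i<n. cnj (v $ i) * (e * v $ i))"
    by (subst sum.swap) (simp add: Aw_i flip: sum_distrib_left)
  also have "\<dots> = e * (\<Sum>i<n. v $ i * cnj (v $ i))"
    by (simp add: sum_distrib_left mult_ac)
  finally have eq: "(\<Sum>j<n. w $ j * cnj (w $ j)) = e * (\<Sum>i<n. v $ i * cnj (v $ i))" .
  define S where "S = (\<Sum>j<n. (cmod (w $ j))\<^sup>2)"
  define T where "T = (\<Sum>i<n. (cmod (v $ i))\<^sup>2)"
  have eq: "complex_of_real S = e * complex_of_real T"
    using eq by (simp only: S_def T_def of_real_sum complex_norm_square)
  from v obtain i where i: "i < n" "v $ i \<noteq> 0" by (metis eq_vecI carrier_vecD index_zero_vec)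
  have "T > 0" unfolding T_def by (rule sum_pos2[of _ i]) (use i in auto)
  hence "e = complex_of_real (S / T)" using eq by (simp add: eq_divide_eq)
  moreover have "S / T \<ge> 0"
    unfolding S_def T_def by (intro divide_nonneg_nonneg sum_nonneg) auto
  ultimately show "e = complex_of_real (Re e)" "Re e \<ge> 0" by simp_all
qed

text \<open>
  The inequality of arithmetic and geometric means, in the form needed for a mean of at most 1:
  it is the product of the inequalities \<open>x \<le> exp (x - 1)\<close>.
\<close>

lemma prod_list_le_exp_sum:
  "(\<And>x. x \<in> set xs \<Longrightarrow> 0 \<le> x) \<Longrightarrow> prod_list xs \<le> exp (sum_list xs - real (length xs))"
proof (induction xs)
  case (Cons x xs)
  have "x * prod_list xs \<le> exp (x - 1) * exp (sum_list xs - real (length xs))"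
    using Cons exp_ge_add_one_self[of "x - 1"] by (intro mult_mono) (auto intro: prod_list_nonneg)
  thus ?case by (simp add: algebra_simps flip: exp_add)
qed simp

text \<open>
  With \<open>G\<close> the product of \<open>A\<close> and its adjoint, \<open>\<bar>det A\<bar>\<^sup>2 = det G\<close> is the product of the \<open>n\<close>
  nonnegative eigenvalues of \<open>G\<close>. Their sum is the trace of \<open>G\<close>, which is the sum of the squared
  row norms and hence at most \<open>n\<close>.
\<close>

lemma hadamard_det_le_1:
  fixes A :: "complex mat"
  assumes A: "A \<in> carrier_mat n n"
    and rows: "\<And>i. i < n \<Longrightarrow> (\<Sum>j<n. (cmod (A $$ (i,j)))\<^sup>2) \<le> 1"
  shows "cmod (det A) \<le> 1"
proof -
  define H where "H = transpose_mat (map_mat cnj A)"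
  define G where "G = A * H"
  have H: "H \<in> carrier_mat n n" using A by (simp add: H_def)
  have G: "G \<in> carrier_mat n n" using A H by (simp add: G_def)
  interpret cnj: comm_ring_hom cnj by unfold_locales auto
  have "det H = cnj (det A)"
    using A by (simp add: H_def det_transpose[of _ n] cnj.hom_det)
  hence detG: "det G = complex_of_real ((cmod (det A))\<^sup>2)"
    using A H by (simp only: G_def det_mult complex_norm_square)
  obtain es where es: "char_poly G = (\<Prod>e\<leftarrow>es. [:- e, 1:])" "length es = n"
    using char_poly_factorized[OF G] by blast
  obtain B P Q where "schur_decomposition G es = (B, P, Q)"
    by (cases "schur_decomposition G es")
  from schur_decomposition[OF G es(1) this]
  have sim: "similar_mat_wit G B P Q" and up: "upper_triangular B" and diag: "diag_mat B = es"
    by auto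
  have B: "B \<in> carrier_mat n n" using similar_mat_witD2[OF G sim] by auto
  have det_es: "det G = prod_list es"
    using det_similar[of G B] sim det_upper_triangular[OF up B] diag
    by (auto simp: similar_mat_def)
  have eig: "e = complex_of_real (Re e)" "Re e \<ge> 0" if "e \<in> set es" for e
  proof -
    have "eigenvalue G e"
      unfolding eigenvalue_root_char_poly[OF G] es(1) poly_prod_list
      using that by (auto simp: prod_list_zero_iff)
    thus "e = complex_of_real (Re e)" "Re e \<ge> 0"
      using eigenvalue_mult_adjoint[OF A] unfolding G_def H_def by blast+
  qed
  have "sum_list es = (\<Sum>i<n. B $$ (i,i))"
    using B by (simp add: diag_mat_def sum_list_sum_nth atLeast0LessThan flip: diag)
  also have "\<dots> = (\<Sum>i<n. G $$ (i,i))" by (rule trace_similar_mat_wit[OF sim G, symmetric])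
  also have "\<dots> = (\<Sum>i<n. complex_of_real (\<Sum>j<n. (cmod (A $$ (i,j)))\<^sup>2))"
    using A by (intro sum.cong refl)
      (auto simp: G_def H_def scalar_prod_def atLeast0LessThan complex_norm_square simp del: of_real_power)
  finally have "sum_list es = complex_of_real (\<Sum>i<n. \<Sum>j<n. (cmod (A $$ (i,j)))\<^sup>2)" by simp
  hence "Re (sum_list es) = (\<Sum>i<n. \<Sum>j<n. (cmod (A $$ (i,j)))\<^sup>2)" by simp
  also have "\<dots> \<le> (\<Sum>i<n. 1)" by (intro sum_mono rows) auto
  finally have tr: "Re (sum_list es) \<le> real n" by simp
  have re: "Re (sum_list es) = sum_list (map Re es)" for es by (induction es) auto
  have "prod_list es = complex_of_real (prod_list (map Re es))"
    using eig by (induction es) (auto simp: complex_is_Real_iff)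
  hence "(cmod (det A))\<^sup>2 = prod_list (map Re es)"
    using detG det_es by (metis of_real_eq_iff)
  also have "\<dots> \<le> exp (sum_list (map Re es) - real (length (map Re es)))"
    using eig by (intro prod_list_le_exp_sum) auto
  also have "\<dots> \<le> exp 0" using tr re es by simp
  finally show ?thesis by (simp add: power_le_one_iff)
qed

section \<open>A Vandermonde determinant on the sphere\<close>

lemma det_scale_rows_cols:
  fixes a :: "nat \<Rightarrow> nat \<Rightarrow> 'a :: comm_ring_1"
  shows "det (mat n n (\<lambda>(i,k). x i * a i k * y k))
     = (\<Prod>i<n. x i) * (\<Prod>k<n. y k) * det (mat n n (\<lambda>(i,k). a i k))"
proof -
  have "det (mat n n (\<lambda>(i,k). x i * a i k * y k))
      = (\<Sum>p | p permutes {0..<n}. signof p * (\<Prod>i = 0..<n. x i * a i (p i) * y (p i)))"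
    by (subst det_def'[of _ n]) (auto intro!: sum.cong prod.cong simp: permutes_in_image)
  also have "\<dots> = (\<Sum>p | p permutes {0..<n}.
      (\<Prod>i<n. x i) * (\<Prod>k<n. y k) * (signof p * (\<Prod>i = 0..<n. a i (p i))))"
  proof (intro sum.cong refl)
    fix p assume "p \<in> {p. p permutes {0..<n}}"
    hence "(\<Prod>i = 0..<n. y (p i)) = (\<Prod>i = 0..<n. y i)"
      using prod.permute[of p "{0..<n}" y] by (simp add: o_def)
    thus "signof p * (\<Prod>i = 0..<n. x i * a i (p i) * y (p i))
        = (\<Prod>i<n. x i) * (\<Prod>k<n. y k) * (signof p * (\<Prod>i = 0..<n. a i (p i)))"
      by (simp add: prod.distrib atLeast0LessThan mult_ac)
  qed
  also have "\<dots> = (\<Prod>i<n. x i) * (\<Prod>k<n. y k) * det (mat n n (\<lambda>(i,k). a i k))"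
    by (subst det_def'[of _ n])
       (auto intro!: sum.cong prod.cong simp: permutes_in_image simp flip: sum_distrib_left)
  finally show ?thesis .
qed

text \<open>
  The Newton basis \<open>q\<^sub>k = (\<Prod>j<k. x - z\<^sub>j)\<close> is monic, so that passing from the monomials to it is
  an upper triangular change of basis of determinant 1. The values \<open>q\<^sub>k(z\<^sub>i)\<close> form a lower triangular
  matrix.
\<close>

lemma det_vandermonde:
  fixes z :: "nat \<Rightarrow> 'a :: field"
  shows "det (mat n n (\<lambda>(i,k). z i ^ k)) = (\<Prod>k<n. \<Prod>j<k. (z k - z j))"
proof -
  define q where "q k = (\<Prod>j<k. [:- z j, 1:])" for k
  have deg_q: "degree (q k) = k" and lead_q: "coeff (q k) k = 1" for k
  proof -
    show deg: "degree (q k) = k"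
      unfolding q_def by (subst degree_prod_sum_eq) auto
    have "monic (q k)" unfolding q_def by (intro monic_prod) auto
    thus "coeff (q k) k = 1" by (simp only: deg)
  qed
  define V where "V = mat n n (\<lambda>(i,k). z i ^ k)"
  define U where "U = mat n n (\<lambda>(l,k). coeff (q k) l)"
  define L where "L = mat n n (\<lambda>(i,k). poly (q k) (z i))"
  have carr: "V \<in> carrier_mat n n" "U \<in> carrier_mat n n" "L \<in> carrier_mat n n"
    by (simp_all add: V_def U_def L_def)
  have "V * U = L"
  proof (rule eq_matI)
    fix i k assume ik: "i < dim_row L" "k < dim_col L"
    hence ik: "i < n" "k < n" by (auto simp: L_def)
    have "(V * U) $$ (i,k) = (\<Sum>l<n. coeff (q k) l * z i ^ l)"
      using ik by (simp add: V_def U_def scalar_prod_def atLeast0LessThan mult.commute)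
    also have "\<dots> = (\<Sum>l\<le>k. coeff (q k) l * z i ^ l)"
      using ik deg_q[of k] by (intro sum.mono_neutral_right) (auto simp: coeff_eq_0)
    also have "\<dots> = L $$ (i,k)" using ik deg_q[of k] by (simp add: L_def poly_altdef)
    finally show "(V * U) $$ (i,k) = L $$ (i,k)" .
  qed (auto simp: V_def U_def L_def)
  hence "det V * det U = det L" using carr by (metis det_mult)
  moreover have "det U = 1"
  proof -
    have "upper_triangular U"
      unfolding upper_triangular_def using deg_q by (auto simp: U_def coeff_eq_0)
    from det_upper_triangular[OF this carr(2)] show ?thesis
      using lead_q by (simp add: prod_list_diag_prod U_def)
  qed
  moreover have "det L = (\<Prod>k<n. \<Prod>j<k. (z k - z j))"
  proof -
    have "L $$ (i,k) = 0" if "i < k" "k < n" for i k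
      using that by (auto simp: L_def q_def poly_prod)
    hence "det L = prod_list (diag_mat L)" by (intro det_lower_triangular[OF _ carr(3)]) auto
    also have "\<dots> = (\<Prod>k<n. \<Prod>j<k. (z k - z j))"
      by (simp add: prod_list_diag_prod L_def q_def poly_prod atLeast0LessThan)
    finally show ?thesis .
  qed
  ultimately show ?thesis by (simp add: V_def)
qed

text \<open>
  Hadamard's inequality for the matrix with entries
  \<open>sqrt (n - 1 choose k) * z\<^sub>i\<^sup>k / sqrt (1 + \<bar>z\<^sub>i\<bar>\<^sup>2) ^ (n - 1)\<close>. Its rows are the normalised evaluation
  functionals at the points \<open>z\<^sub>i\<close> on polynomials of degree below \<open>n\<close> with the Weyl norm; they are
  unit vectors by the binomial theorem.
\<close>

lemma vandermonde_binomial_le: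
  fixes z :: "nat \<Rightarrow> complex"
  assumes "n \<ge> 1"
  shows "(\<Prod>k<n. \<Prod>j<k. cmod (z k - z j))\<^sup>2 * (\<Prod>k<n. real (n - 1 choose k))
       \<le> (\<Prod>i<n. 1 + (cmod (z i))\<^sup>2) ^ (n - 1)"
proof -
  define s where "s i = 1 + (cmod (z i))\<^sup>2" for i
  have s: "s i > 0" for i by (simp add: s_def add_pos_nonneg)
  define x where "x i = complex_of_real (1 / sqrt (s i) ^ (n - 1))" for i
  define y where "y k = complex_of_real (sqrt (real (n - 1 choose k)))" for k
  define A where "A = mat n n (\<lambda>(i,k). x i * z i ^ k * y k)"
  have "(cmod (A $$ (i,k)))\<^sup>2 = real (n - 1 choose k) * ((cmod (z i))\<^sup>2) ^ k / s i ^ (n - 1)"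
    if "i < n" "k < n" for i k
    using that s[of i]
    by (simp add: A_def x_def y_def norm_mult norm_power norm_divide power_mult_distrib power_divide
        flip: power_mult power_even_eq) (simp add: mult.commute power_mult real_sqrt_pow2)
  hence "(\<Sum>k<n. (cmod (A $$ (i,k)))\<^sup>2)
      = (\<Sum>k<n. real (n - 1 choose k) * ((cmod (z i))\<^sup>2) ^ k) / s i ^ (n - 1)" if "i < n" for i
    using that by (simp add: sum_divide_distrib)
  moreover have "(\<Sum>k<n. real (n - 1 choose k) * ((cmod (z i))\<^sup>2) ^ k) = s i ^ (n - 1)" for i
  proof -
    have "{..<n} = {..n - 1}" using assms by auto
    thus ?thesis
      using binomial_ring[of "(cmod (z i))\<^sup>2" 1 "n - 1"] by (simp add: s_def add.commute)
  qed
  ultimately have "cmod (det A) \<le> 1"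
    using s by (intro hadamard_det_le_1[of _ n]) (auto simp: A_def less_imp_neq[symmetric])
  moreover have "cmod (det A) = (\<Prod>i<n. 1 / sqrt (s i) ^ (n - 1)) * (\<Prod>k<n. sqrt (real (n - 1 choose k)))
      * (\<Prod>k<n. \<Prod>j<k. cmod (z k - z j))"
    unfolding A_def det_scale_rows_cols det_vandermonde norm_mult prod_norm[symmetric] x_def y_def
    using s by (simp add: less_imp_le norm_divide norm_power)
  ultimately have "((\<Prod>i<n. 1 / sqrt (s i) ^ (n - 1)) * (\<Prod>k<n. sqrt (real (n - 1 choose k)))
      * (\<Prod>k<n. \<Prod>j<k. cmod (z k - z j)))\<^sup>2 \<le> 1"
    by (metis norm_ge_zero power_le_one)
  moreover have "(\<Prod>i<n. 1 / sqrt (s i) ^ (n - 1))\<^sup>2 = 1 / (\<Prod>i<n. s i) ^ (n - 1)"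
  proof -
    have "(1 / sqrt (s i) ^ (n - 1))\<^sup>2 = 1 / s i ^ (n - 1)" for i
      using s[of i] by (simp add: power_divide power_mult[symmetric] mult.commute)
        (simp add: power_mult)
    hence "(\<Prod>i<n. 1 / sqrt (s i) ^ (n - 1))\<^sup>2 = (\<Prod>i<n. 1 / s i ^ (n - 1))"
      by (simp only: prod_power_distrib)
    thus ?thesis by (simp add: prod_power_distrib prod_dividef)
  qed
  moreover have "(\<Prod>k<n. sqrt (real (n - 1 choose k)))\<^sup>2 = (\<Prod>k<n. real (n - 1 choose k))"
    by (simp add: prod_power_distrib)
  moreover have "(\<Prod>i<n. s i) ^ (n - 1) > 0" using s by (intro zero_less_power prod_pos) auto
  ultimately show ?thesis
    by (simp add: power_mult_distrib s_def[symmetric] field_simps)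
qed

section \<open>The product of a row of Pascal's triangle\<close>

text \<open>
  Stirling's formula as an upper bound, \<open>fact n \<le> exp 1 * sqrt n * (n / exp 1)\<^sup>n\<close>. The induction step
  is \<open>(n + 1/2) * ln (1 + 1/n) \<ge> 1\<close>.
\<close>

lemma ln_fact_le:
  assumes "n \<ge> 1"
  shows "ln (fact n) \<le> 1 + ln (real n) / 2 + real n * ln (real n) - real n"
  using assms
proof (induction n rule: nat_induct_at_least)
  case (Suc n)
  have n: "real n > 0" using Suc.hyps by simp
  have "2 * (real n + 1 - real n) / (real n + (real n + 1)) \<le> ln (real n + 1) - ln (real n)"
    using n by (intro ln_inverse_approx_ge) auto
  hence "2 * (real n + 1 - real n) \<le> (ln (real n + 1) - ln (real n)) * (real n + (real n + 1))"
    by (rule iffD1[OF pos_divide_le_eq, rotated]) (use n in simp)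
  moreover have "ln (fact (Suc n)) = ln (real n + 1) + ln (fact n :: real)"
    by (simp add: ln_mult add.commute)
  ultimately show ?case using Suc.IH by (simp add: algebra_simps)
qed simp

lemma prod_binomial_Suc:
  "(\<Prod>k<Suc n. real (n choose k)) = (\<Prod>k<n. real (n - 1 choose k)) * real n ^ n / fact n"
proof -
  have "real (n - k) * real (n choose k) = real n * real (n - 1 choose k)" for k
    by (metis binomial_absorb_comp of_nat_mult)
  hence "(\<Prod>k<n. real (n - k) * real (n choose k)) = (\<Prod>k<n. real n * real (n - 1 choose k))"
    by (simp only:)
  hence "(\<Prod>k<n. real (n - k)) * (\<Prod>k<n. real (n choose k)) = real n ^ n * (\<Prod>k<n. real (n - 1 choose k))"
    by (simp only: prod.distrib prod_constant card_lessThan)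
  moreover have "(\<Prod>k<n. real (n - k)) = fact n"
    by (simp add: fact_prod_rev atLeast0LessThan)
  ultimately show ?thesis by (simp add: field_simps)
qed

lemma prod_binomial_pos: "(\<Prod>k<n. real (n - 1 choose k)) > 0"
proof (rule prod_pos)
  fix k assume "k \<in> {..<n}"
  hence "k \<le> n - 1" by auto
  thus "real (n - 1 choose k) > 0" by simp
qed

text \<open>
  From one row to the next the product grows by the factor \<open>n\<^sup>n / fact n\<close>, which Stirling's bound
  estimates from below. The term \<open>n * ln n / 2\<close> is exact to within \<open>O(n)\<close>; it is what
  produces the factor \<open>sqrt n\<close> after taking an \<open>n\<close>-th root.
\<close>

lemma ln_prod_binomial_ge:
  assumes "n \<ge> 1"
  shows "ln (\<Prod>k<n. real (n - 1 choose k)) \<ge> real n * (real n - ln (real n) - 3) / 2"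
  using assms
proof (induction n rule: nat_induct_at_least)
  case (Suc n)
  define G where "G = (\<Prod>k<n. real (n - 1 choose k))"
  have IH: "real n * (real n - ln (real n) - 3) / 2 \<le> ln G"
    using Suc.IH by (simp only: G_def)
  have "G > 0" unfolding G_def by (rule prod_binomial_pos)
  hence "ln (G * real n ^ n / fact n) = ln G + real n * ln (real n) - ln (fact n)"
    using Suc by (simp add: ln_div ln_mult ln_realpow)
  hence "ln (\<Prod>k<Suc n. real (n choose k)) = ln G + real n * ln (real n) - ln (fact n)"
    by (simp only: prod_binomial_Suc G_def)
  moreover have "(real n + 1) * ln (real n) \<le> (real n + 1) * ln (real n + 1)"
    using Suc.hyps by (intro mult_left_mono) auto
  hence "(real n + 1) * (real n + 1 - ln (real n + 1) - 3) / 2 \<le> ln G + real n * ln (real n) - ln (fact n)"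
    using IH ln_fact_le[OF Suc.hyps] by (simp add: field_simps)
  ultimately show ?case by (simp add: add.commute)
next
  case base
  have "{..<1} = {0 :: nat}" by auto
  thus ?case by simp
qed

section \<open>Separation of the zeros\<close>

lemma prod_off_diagonal:
  fixes f :: "nat \<Rightarrow> nat \<Rightarrow> 'a :: comm_semiring_1"
  assumes sym: "\<And>i j. f i j = f j i"
  shows "(\<Prod>i<n. \<Prod>j\<in>{..<n}-{i}. f i j) = (\<Prod>k<n. \<Prod>j<k. f k j)\<^sup>2"
proof (induction n)
  case (Suc n)
  have "(\<Prod>j\<in>{..<Suc n}-{i}. f i j) = f i n * (\<Prod>j\<in>{..<n}-{i}. f i j)" if "i < n" for i
  proof -
    have "{..<Suc n} - {i} = insert n ({..<n} - {i})" using that by auto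
    thus ?thesis by simp
  qed
  moreover have "{..<Suc n} - {n} = {..<n}" by auto
  ultimately have "(\<Prod>i<Suc n. \<Prod>j\<in>{..<Suc n}-{i}. f i j)
      = (\<Prod>i<n. f i n) * (\<Prod>i<n. \<Prod>j\<in>{..<n}-{i}. f i j) * (\<Prod>j<n. f n j)"
    by (simp add: prod.distrib)
  also have "(\<Prod>i<n. f i n) = (\<Prod>j<n. f n j)" by (intro prod.cong refl sym)
  finally show ?case by (simp add: Suc.IH power2_eq_square mult_ac)
qed simp

text \<open>
  The geometric mean of the left-hand sides over all \<open>i\<close> is at most that of the right-hand sides:
  the former is a squared Vandermonde determinant, and the powers of \<open>1 + \<bar>z\<^sub>i\<bar>\<^sup>2\<close> on the right
  multiply up to exactly the power in \<open>vandermonde_binomial_le\<close>.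
\<close>

lemma ex_small_root_product:
  fixes z :: "nat \<Rightarrow> complex"
  assumes n: "n \<ge> 1"
  shows "\<exists>i<n. (\<Prod>j\<in>{..<n}-{i}. cmod (z i - z j))
    \<le> exp ((3 - real n) / 2) * sqrt (real n) * (1 + (cmod (z i))\<^sup>2) powr (real n / 2 - 1)
       * sqrt (\<Prod>j<n. 1 + (cmod (z j))\<^sup>2)"
proof (rule ccontr)
  define s where "s i = 1 + (cmod (z i))\<^sup>2" for i
  have s: "s i > 0" for i by (simp add: s_def add_pos_nonneg)
  define S where "S = (\<Prod>i<n. s i)"
  have S: "S > 0" unfolding S_def using s by (intro prod_pos) auto
  define D where "D i = (\<Prod>j\<in>{..<n}-{i}. cmod (z i - z j))" for i
  define B where "B = (\<Prod>k<n. real (n - 1 choose k))"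
  have B: "B > 0" unfolding B_def by (rule prod_binomial_pos)
  \<comment> \<open>The constant is chosen so that \<open>K ^ n * B \<ge> 1\<close> is the bound on the binomial coefficients.\<close>
  define K where "K = exp ((3 - real n) / 2) * sqrt (real n)"
  have K: "K > 0" using n by (simp add: K_def)
  define X where "X i = K * s i powr (real n / 2 - 1) * sqrt S" for i
  assume "\<not> ?thesis"
  hence less: "X i < D i" if "i < n" for i
    using that by (auto simp: X_def D_def K_def S_def s_def not_le)
  have X: "X i > 0" for i unfolding X_def using K S s[of i] by simp
  have "(\<Prod>i<n. X i) < (\<Prod>i<n. D i)"
    using n X less order.strict_trans[OF X less]
    by (intro prod_mono_strict) (auto simp: less_imp_le lessThan_empty_iff)
  also have "(\<Prod>i<n. D i) * B \<le> S ^ (n - 1)"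
    using vandermonde_binomial_le[OF n, of z] prod_off_diagonal[of "\<lambda>i j. cmod (z i - z j)" n]
    by (simp add: D_def B_def S_def s_def norm_minus_commute)
  hence "(\<Prod>i<n. D i) \<le> S ^ (n - 1) / B" using B by (simp add: pos_le_divide_eq)
  also have "(\<Prod>i<n. X i) = K ^ n * S ^ (n - 1)"
  proof -
    have "(\<Prod>i<n. X i) = K ^ n * ((\<Prod>i<n. s i powr (real n / 2 - 1)) * sqrt S ^ n)"
      by (simp add: X_def prod.distrib)
    also have "(\<Prod>i<n. s i powr (real n / 2 - 1)) = S powr (real n / 2 - 1)"
      unfolding S_def using s by (subst prod_powr_distrib) (auto simp: less_imp_le)
    also have "sqrt S ^ n = S powr (real n / 2)"
      using S by (simp add: powr_half_sqrt[symmetric] powr_powr flip: powr_realpow)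
    also have "S powr (real n / 2 - 1) * S powr (real n / 2) = S powr real (n - 1)"
      using n by (simp add: of_nat_diff flip: powr_add)
    finally show ?thesis using S by (simp add: powr_realpow del: of_nat_diff)
  qed
  finally have "K ^ n * B < 1" using S B by (simp add: field_simps)
  hence "ln (K ^ n * B) < 0" using K B by (simp add: ln_less_zero)
  moreover have "ln (K ^ n * B) = real n * ln K + ln B"
    using K B by (simp add: ln_mult ln_realpow)
  moreover have "ln K = (3 - real n) / 2 + ln (real n) / 2"
    using n by (simp add: K_def ln_mult ln_sqrt)
  ultimately show False
    using ln_prod_binomial_ge[OF n] by (simp add: B_def field_simps)
qed

section \<open>A lower bound for the Weyl norm\<close>

text \<open>
  Landau's inequality between the mean square of a polynomial on the unit circle and its Mahler
  measure, rescaled to the circle of radius \<open>sqrt t\<close>.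
\<close>

lemma landau_weighted:
  assumes P: "P = smult c (\<Prod>j<n. [:- z j, 1:])" and "t > 0"
  shows "(cmod c)\<^sup>2 * (\<Prod>j<n. max t ((cmod (z j))\<^sup>2)) \<le> (\<Sum>k\<le>n. (cmod (coeff P k))\<^sup>2 * t ^ k)"
proof (cases "c = 0")
  case False
  define r where "r = sqrt t"
  have r: "r > 0" "r\<^sup>2 = t" using \<open>t > 0\<close> by (auto simp: r_def)
  define f where "f = pcompose P [:0, complex_of_real r:]"
  have "[:- z j, complex_of_real r:] = smult (complex_of_real r) [:- (z j / complex_of_real r), 1:]" for j
    using r by simp
  hence "f = smult (c * complex_of_real r ^ n) (\<Prod>j<n. [:- (z j / complex_of_real r), 1:])"
    by (simp add: f_def P pcompose_smult pcompose_prod pcompose_pCons prod_smult del: smult_pCons)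
  also have "(\<Prod>j<n. [:- (z j / complex_of_real r), 1:])
      = (\<Prod>a\<leftarrow>map (\<lambda>j. z j / complex_of_real r) [0..<n]. [:- a, 1:])"
    by (simp add: o_def prod.list_conv_set_nth atLeast0LessThan)
  finally have f: "f = smult (c * complex_of_real r ^ n) \<dots>" .
  have "degree P = n" using False by (simp add: P degree_prod_sum_eq)
  hence deg: "degree f = n" using r by (simp add: f_def)
  have "f \<noteq> 0" using False r by (auto simp: f)
  have "mahler_measure_poly f = cmod c * r ^ n * (\<Prod>j<n. max 1 (cmod (z j) / r))"
    unfolding f mahler_measure_poly_explicit
    using r by (simp add: norm_mult norm_power norm_divide o_def prod.list_conv_set_nth atLeast0LessThan)
  moreover have "(\<Sum>a\<leftarrow>coeffs f. (cmod a)\<^sup>2) = (\<Sum>k\<le>n. (cmod (coeff P k))\<^sup>2 * t ^ k)"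
  proof -
    have "(\<Sum>a\<leftarrow>coeffs f. (cmod a)\<^sup>2) = (\<Sum>k\<le>n. (cmod (coeff f k))\<^sup>2)"
      using \<open>f \<noteq> 0\<close> by (simp add: coeffs_def deg sum_list_sum_nth o_def atLeast0LessThan
          lessThan_Suc_atMost del: upt_Suc)
    also have "\<dots> = (\<Sum>k\<le>n. (cmod (coeff P k))\<^sup>2 * t ^ k)"
      using r by (intro sum.cong refl)
        (simp add: f_def coeff_pcompose_linear norm_mult norm_power power_mult_distrib
          power_mult[symmetric] mult.commute flip: r(2))
    finally show ?thesis .
  qed
  ultimately have le: "cmod c * r ^ n * (\<Prod>j<n. max 1 (cmod (z j) / r))
      \<le> sqrt (\<Sum>k\<le>n. (cmod (coeff P k))\<^sup>2 * t ^ k)"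
    using Landau_inequality[of f] by simp
  have "0 \<le> cmod c * r ^ n * (\<Prod>j<n. max 1 (cmod (z j) / r))"
    using r by (intro mult_nonneg_nonneg prod_nonneg) auto
  with le have "(cmod c * r ^ n * (\<Prod>j<n. max 1 (cmod (z j) / r)))\<^sup>2
      \<le> (sqrt (\<Sum>k\<le>n. (cmod (coeff P k))\<^sup>2 * t ^ k))\<^sup>2"
    by (rule power_mono)
  also have "\<dots> = (\<Sum>k\<le>n. (cmod (coeff P k))\<^sup>2 * t ^ k)"
    using \<open>t > 0\<close> by (intro real_sqrt_pow2 sum_nonneg) auto
  finally have "(cmod c * r ^ n * (\<Prod>j<n. max 1 (cmod (z j) / r)))\<^sup>2
      \<le> (\<Sum>k\<le>n. (cmod (coeff P k))\<^sup>2 * t ^ k)" .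
  also have "cmod c * r ^ n * (\<Prod>j<n. max 1 (cmod (z j) / r)) = cmod c * (\<Prod>j<n. max r (cmod (z j)))"
  proof -
    have "max r (cmod (z j)) = r * max 1 (cmod (z j) / r)" for j
      using r by (simp add: max_mult_distrib_left)
    thus ?thesis by (simp add: prod.distrib)
  qed
  also have "(cmod c * (\<Prod>j<n. max r (cmod (z j))))\<^sup>2 = (cmod c)\<^sup>2 * (\<Prod>j<n. max t ((cmod (z j))\<^sup>2))"
  proof -
    have "(max r (cmod (z j)))\<^sup>2 = max t ((cmod (z j))\<^sup>2)" for j
      using r by (auto simp: max_def)
    thus ?thesis by (simp add: power_mult_distrib prod_power_distrib)
  qed
  finally show ?thesis .
next
  case True
  have "0 \<le> (\<Sum>k\<le>n. (cmod (coeff P k))\<^sup>2 * t ^ k)"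
    using \<open>t > 0\<close> by (intro sum_nonneg) auto
  with True show ?thesis by simp
qed

text \<open>
  The beta integral: it expresses the weights of the Weyl norm as an average over
  \<open>u = \<bar>w\<bar>\<^sup>2 / (1 + \<bar>w\<bar>\<^sup>2)\<close>, the normalised height of \<open>w\<close> on the sphere. By Archimedes' theorem \<open>u\<close> is
  uniformly distributed on the unit interval.
\<close>

lemma has_integral_bernstein:
  assumes "k \<le> n"
  shows "((\<lambda>u::real. u ^ k * (1 - u) ^ (n - k)) has_integral
           inverse (real (n + 1) * real (n choose k))) {0<..<1}"
proof -
  have "Beta (real k + 1) (real (n - k) + 1) = fact k * fact (n - k) / fact (n + 1)"
    using Gamma_fact[of k, where ?'a = real] Gamma_fact[of "n - k", where ?'a = real]
      Gamma_fact[of "n + 1", where ?'a = real] assms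
    by (simp add: Beta_def of_nat_diff add.commute)
  also have "\<dots> = inverse (real (n + 1) * real (n choose k))"
    using assms by (simp add: binomial_fact field_simps)
  finally have "((\<lambda>u::real. u powr (real k + 1 - 1) * (1 - u) powr (real (n - k) + 1 - 1)) has_integral
           inverse (real (n + 1) * real (n choose k))) {0<..<1}"
    using has_integral_Beta_real[of "real k + 1" "real (n - k) + 1"]
    by (simp add: has_integral_Icc_iff_Ioo)
  thus ?thesis
    by (rule has_integral_eq[rotated]) (auto simp: powr_realpow simp del: of_nat_diff)
qed

text \<open>
  At the left end point \<open>x * ln x\<close> takes the value 0 because of the factor \<open>x\<close>, and this agrees with
  its limit.
\<close>

lemma continuous_on_mult_ln: "continuous_on {0..} (\<lambda>x::real. x * ln x)"
  unfolding continuous_on_def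
proof
  fix x :: real assume x: "x \<in> {0..}"
  show "((\<lambda>x. x * ln x) \<longlongrightarrow> x * ln x) (at x within {0..})"
  proof (cases "x = 0")
    case True
    have "((\<lambda>x::real. x * ln x) \<longlongrightarrow> 0) (at_right 0)" by real_asymp
    moreover have "at 0 within {0..} = at_right (0::real)"
      unfolding at_within_def by (rule arg_cong[where f = "\<lambda>S. inf (nhds 0) (principal S)"]) auto
    ultimately show ?thesis using True by simp
  qed (use x in \<open>auto intro!: tendsto_intros\<close>)
qed

text \<open>
  The geometric mean of the squared half chordal distance from a point of normalised height \<open>b\<close> to
  the points of the circle of latitude at height \<open>u\<close>.
\<close>

definition latitude_mean :: "real \<Rightarrow> real \<Rightarrow> real" where
  "latitude_mean b u = max (u * (1 - b)) (b * (1 - u))"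

text \<open>
  The value does not depend on \<open>b\<close>, by the rotational symmetry of the sphere. Here it follows from
  explicit antiderivatives on both sides of \<open>u = b\<close>, where the maximum switches. For \<open>b = 0\<close>
  the integrand has a logarithmic singularity at 0, but the antiderivative is still continuous there.
\<close>

lemma has_integral_ln_latitude_mean:
  assumes b: "0 \<le> b" "b < 1"
  shows "((\<lambda>u. ln (latitude_mean b u)) has_integral -1) {0<..<1}"
proof -
  define F where "F u = u * ln b - (1 - u) * ln (1 - u) - u" for u :: real
  define G where "G u = u * ln u - u + u * ln (1 - b)" for u :: real
  have "((\<lambda>u. ln (latitude_mean b u)) has_integral (F b - F 0)) {0..b}"
  proof (rule fundamental_theorem_of_calculus_interior)
    show "continuous_on {0..b} F"
      unfolding F_def using b by (intro continuous_intros) auto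
    fix u assume u: "u \<in> {0<..<b}"
    have "latitude_mean b u = b * (1 - u)"
      using u by (simp add: latitude_mean_def algebra_simps)
    hence "ln (latitude_mean b u) = ln b + ln (1 - u)" using u b by (simp add: ln_mult)
    moreover have "(F has_real_derivative ln b + ln (1 - u)) (at u)"
      unfolding F_def using u b by (auto intro!: derivative_eq_intros)
    ultimately show "(F has_vector_derivative ln (latitude_mean b u)) (at u)"
      by (simp add: has_real_derivative_iff_has_vector_derivative)
  qed (use b in auto)
  moreover have "((\<lambda>u. ln (latitude_mean b u)) has_integral (G 1 - G b)) {b..1}"
  proof (rule fundamental_theorem_of_calculus_interior)
    show "continuous_on {b..1} G"
      unfolding G_def using b
      by (intro continuous_intros continuous_on_subset[OF continuous_on_mult_ln]) auto
    fix u assume u: "u \<in> {b<..<1}"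
    have "latitude_mean b u = u * (1 - b)"
      using u by (simp add: latitude_mean_def algebra_simps)
    hence "ln (latitude_mean b u) = ln u + ln (1 - b)" using u b by (simp add: ln_mult)
    moreover have "(G has_real_derivative ln u + ln (1 - b)) (at u)"
      unfolding G_def using u b by (auto intro!: derivative_eq_intros)
    ultimately show "(G has_vector_derivative ln (latitude_mean b u)) (at u)"
      by (simp add: has_real_derivative_iff_has_vector_derivative)
  qed (use b in auto)
  ultimately have "((\<lambda>u. ln (latitude_mean b u)) has_integral (F b - F 0) + (G 1 - G b)) {0..1}"
    using b by (intro has_integral_combine[of 0 b 1]) auto
  also have "(F b - F 0) + (G 1 - G b) = -1" by (simp add: F_def G_def algebra_simps)
  finally show ?thesis by (simp add: has_integral_Icc_iff_Ioo)
qed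

text \<open>
  Jensen's inequality for the exponential function. The sum of the logarithms has mean \<open>- n\<close>, so the
  tangent of \<open>exp\<close> at \<open>- n\<close> is integrated.
\<close>

lemma integral_prod_latitude_mean_ge:
  assumes b: "\<And>j. j < n \<Longrightarrow> 0 \<le> b j \<and> b j < 1"
    and int: "((\<lambda>u. \<Prod>j<n. latitude_mean (b j) u) has_integral I) {0<..<1}"
  shows "I \<ge> exp (- real n)"
proof -
  have "((\<lambda>u. \<Sum>j<n. ln (latitude_mean (b j) u)) has_integral (\<Sum>j<n. -1)) {0<..<1}"
    using b by (intro has_integral_sum has_integral_ln_latitude_mean) auto
  moreover have "((\<lambda>u::real. 1 + real n) has_integral (1 + real n)) {0<..<1}"
    using has_integral_const_real[of "1 + real n" 0 1] by (simp add: has_integral_Icc_iff_Ioo)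
  ultimately have "((\<lambda>u. (1 + real n) + (\<Sum>j<n. ln (latitude_mean (b j) u))) has_integral
          ((1 + real n) + (\<Sum>j<n. -1))) {0<..<1}"
    by (rule has_integral_add[rotated])
  hence "((\<lambda>u. exp (- real n) * (1 + real n + (\<Sum>j<n. ln (latitude_mean (b j) u)))) has_integral
          exp (- real n) * (1 + real n + (\<Sum>j<n. -1))) {0<..<1}"
    by (rule has_integral_mult_right)
  hence "((\<lambda>u. exp (- real n) * (1 + real n + (\<Sum>j<n. ln (latitude_mean (b j) u)))) has_integral
          exp (- real n)) {0<..<1}" by simp
  from this int show ?thesis
  proof (rule has_integral_le)
    fix u :: real assume u: "u \<in> {0<..<1}"
    define L where "L = (\<Sum>j<n. ln (latitude_mean (b j) u))"
    have pos: "latitude_mean (b j) u > 0" if "j < n" for j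
      using b[OF that] u unfolding latitude_mean_def by (auto simp: less_max_iff_disj)
    have "exp (- real n) * (1 + real n + L) \<le> exp (- real n) * exp (real n + L)"
      using exp_ge_add_one_self[of "real n + L"] by (intro mult_left_mono) (auto simp: add_ac)
    also have "\<dots> = exp L" by (simp flip: exp_add)
    also have "\<dots> = (\<Prod>j<n. latitude_mean (b j) u)" using pos by (simp add: L_def exp_sum)
    finally show "exp (- real n) * (1 + real n + (\<Sum>j<n. ln (latitude_mean (b j) u)))
        \<le> (\<Prod>j<n. latitude_mean (b j) u)" by (simp add: L_def)
  qed
qed

text \<open>
  The squared Weyl norm is \<open>n + 1\<close> times the integral over \<open>u\<close> of
  \<open>\<Sum>k\<le>n. \<bar>a\<^sub>k\<bar>\<^sup>2 * u\<^sup>k * (1 - u)\<^sup>n\<^sup>-\<^sup>k\<close>. With \<open>t = u / (1 - u)\<close> the integrand is \<open>(1 - u)\<^sup>n\<close> times the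
  mean square of \<open>P\<close> on the circle of radius \<open>sqrt t\<close>. By Landau's inequality it is at least
  a product of latitude means, and Jensen's inequality applies to the integral of that product.
\<close>

lemma weyl_norm_ge:
  assumes P: "P = smult c (\<Prod>j<n. [:- z j, 1:])" and c: "c \<noteq> 0"
  shows "(weyl_norm P)\<^sup>2 \<ge> real (n + 1) * exp (- real n) * ((cmod c)\<^sup>2 * (\<Prod>j<n. 1 + (cmod (z j))\<^sup>2))"
proof -
  have deg: "degree P = n"
    using c by (simp add: P degree_prod_eq_sum_degree)
  define s where "s j = 1 + (cmod (z j))\<^sup>2" for j
  have s: "s j \<ge> 1" for j by (simp add: s_def)
  \<comment> \<open>the height of \<open>z j\<close> on the sphere\<close>
  define b where "b j = (cmod (z j))\<^sup>2 / s j" for j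
  have b: "0 \<le> b j" "b j < 1" for j
    using s[of j] by (simp_all add: b_def divide_less_eq) (simp add: s_def)
  define w where "w u = (\<Sum>k\<le>n. (cmod (coeff P k))\<^sup>2 * (u ^ k * (1 - u) ^ (n - k)))" for u :: real
  define I where "I = integral {0<..<1} (\<lambda>u. \<Prod>j<n. latitude_mean (b j) u)"
  define K where "K = (cmod c)\<^sup>2 * (\<Prod>j<n. s j)"
  have int: "((\<lambda>u. \<Prod>j<n. latitude_mean (b j) u) has_integral I) {0<..<1}"
    unfolding I_def latitude_mean_def has_integral_integral[symmetric] integrable_on_Icc_iff_Ioo[symmetric]
    by (intro integrable_continuous_interval continuous_intros)
  have "(w has_integral (\<Sum>k\<le>n. (cmod (coeff P k))\<^sup>2 * inverse (real (n + 1) * real (n choose k)))) {0<..<1}"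
    unfolding w_def by (intro has_integral_sum has_integral_mult_right has_integral_bernstein) auto
  also have "(\<Sum>k\<le>n. (cmod (coeff P k))\<^sup>2 * inverse (real (n + 1) * real (n choose k)))
      = (weyl_norm P)\<^sup>2 / real (n + 1)"
    by (simp add: weyl_norm_def deg sum_nonneg sum_divide_distrib divide_simps mult.commute)
  finally have "(w has_integral (weyl_norm P)\<^sup>2 / real (n + 1)) {0<..<1}" .
  with has_integral_mult_right[OF int, of K] have "K * I \<le> (weyl_norm P)\<^sup>2 / real (n + 1)"
  proof (rule has_integral_le)
    fix u :: real assume u: "u \<in> {0<..<1}"
    define t where "t = u / (1 - u)"
    have t: "t > 0" using u by (simp add: t_def)
    have "s j * latitude_mean (b j) u = (1 - u) * max t ((cmod (z j))\<^sup>2)" for j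
    proof -
      have sb: "s j * b j = (cmod (z j))\<^sup>2" using s[of j] by (simp add: b_def)
      moreover have "s j * (1 - b j) = 1" by (simp only: right_diff_distrib sb) (simp add: s_def)
      ultimately
      have "s j * (u * (1 - b j)) = u" "s j * (b j * (1 - u)) = (cmod (z j))\<^sup>2 * (1 - u)"
        by (metis mult.left_commute mult.right_neutral, metis mult.assoc)
      moreover have "s j * latitude_mean (b j) u = max (s j * (u * (1 - b j))) (s j * (b j * (1 - u)))"
        using s[of j] by (simp add: latitude_mean_def max_mult_distrib_left)
      ultimately have "s j * latitude_mean (b j) u = max u ((cmod (z j))\<^sup>2 * (1 - u))"
        by (simp only:)
      thus ?thesis using u by (simp add: max_mult_distrib_left t_def mult.commute)
    qed
    hence "K * (\<Prod>j<n. latitude_mean (b j) u) = (1 - u) ^ n * ((cmod c)\<^sup>2 * (\<Prod>j<n. max t ((cmod (z j))\<^sup>2)))"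
      by (simp add: K_def prod.distrib flip: prod.distrib)
    also have "\<dots> \<le> (1 - u) ^ n * (\<Sum>k\<le>n. (cmod (coeff P k))\<^sup>2 * t ^ k)"
      using u t by (intro mult_left_mono landau_weighted[OF P]) auto
    also have "\<dots> = w u"
      unfolding w_def sum_distrib_left
    proof (intro sum.cong refl)
      fix k assume "k \<in> {..n}"
      hence "(1 - u) ^ n = (1 - u) ^ k * (1 - u) ^ (n - k)" by (simp flip: power_add)
      thus "(1 - u) ^ n * ((cmod (coeff P k))\<^sup>2 * t ^ k)
          = (cmod (coeff P k))\<^sup>2 * (u ^ k * (1 - u) ^ (n - k))"
        using u by (simp add: t_def power_divide)
    qed
    finally show "K * (\<Prod>j<n. latitude_mean (b j) u) \<le> w u" .
  qed
  moreover have "K * exp (- real n) \<le> K * I"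
    using integral_prod_latitude_mean_ge[OF _ int] b order_trans[OF zero_le_one s]
    by (intro mult_left_mono) (auto simp: K_def intro!: mult_nonneg_nonneg prod_nonneg)
  ultimately have "K * exp (- real n) \<le> (weyl_norm P)\<^sup>2 / real (n + 1)" by linarith
  hence "K * exp (- real n) * real (n + 1) \<le> (weyl_norm P)\<^sup>2"
    by (simp add: pos_le_divide_eq)
  thus ?thesis by (simp add: K_def s_def mult_ac)
qed

section \<open>The condition number\<close>

lemma poly_pderiv_at_root:
  fixes z :: "nat \<Rightarrow> 'a :: field_char_0"
  assumes "i < n"
  shows "poly (pderiv (smult c (\<Prod>j<n. [:- z j, 1:]))) (z i) = c * (\<Prod>j\<in>{..<n}-{i}. z i - z j)"
proof -
  have "poly (pderiv (smult c (\<Prod>j<n. [:- z j, 1:]))) (z i)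
      = c * (\<Sum>a<n. \<Prod>j\<in>{..<n}-{a}. z i - z j)"
    by (simp add: pderiv_smult pderiv_prod poly_sum poly_prod pderiv_pCons)
  also have "(\<Sum>a<n. \<Prod>j\<in>{..<n}-{a}. z i - z j) = (\<Sum>a\<in>{i}. \<Prod>j\<in>{..<n}-{a}. z i - z j)"
    using assms by (intro sum.mono_neutral_right) (auto intro!: prod_zero)
  finally show ?thesis by simp
qed

text \<open>
  At a multiple zero the condition number is infinite, which is the case where the chosen zero
  annihilates the derivative. At a simple zero the two estimates are combined.
\<close>

lemma ex_mu_norm_at_ge:
  assumes "degree P \<ge> 1"
  shows "\<exists>w. poly P w = 0 \<and> mu_norm_at P w \<ge> ereal (exp (- 3 / 2) * sqrt (real (degree P)))"
proof -
  define n where "n = degree P"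
  have n: "n \<ge> 1" using assms by (simp add: n_def)
  define c where "c = lead_coeff P"
  have c: "c \<noteq> 0" using assms by (auto simp: c_def)
  obtain zs where zs: "smult c (\<Prod>a\<leftarrow>zs. [:- a, 1:]) = P" "length zs = n"
    using fundamental_theorem_algebra_factorized[of P] by (auto simp: c_def n_def)
  define z where "z j = zs ! j" for j
  have P: "P = smult c (\<Prod>j<n. [:- z j, 1:])"
    unfolding zs(1)[symmetric] by (simp add: zs(2) z_def prod.list_conv_set_nth atLeast0LessThan)
  define s where "s j = 1 + (cmod (z j))\<^sup>2" for j
  have s: "s j > 0" for j by (simp add: s_def add_pos_nonneg)
  define S where "S = (\<Prod>j<n. s j)"
  have S: "S > 0" unfolding S_def using s by (intro prod_pos) auto
  obtain i where i: "i < n" and le: "(\<Prod>j\<in>{..<n}-{i}. cmod (z i - z j))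
    \<le> exp ((3 - real n) / 2) * sqrt (real n) * s i powr (real n / 2 - 1) * sqrt S"
    using ex_small_root_product[OF n, of z] by (auto simp: s_def S_def)
  define D where "D = (\<Prod>j\<in>{..<n}-{i}. cmod (z i - z j))"
  define W where "W = weyl_norm P"
  have root: "poly P (z i) = 0" using i by (auto simp: P poly_prod)
  have D: "cmod (poly (pderiv P) (z i)) = cmod c * D"
    unfolding P poly_pderiv_at_root[OF i] by (simp add: norm_mult D_def prod_norm)
  have "mu_norm_at P (z i) \<ge> ereal (exp (- 3 / 2) * sqrt (real n))"
  proof (cases "poly (pderiv P) (z i) = 0")
    case True
    thus ?thesis by (simp add: mu_norm_at_def)
  next
    case False
    hence "D \<noteq> 0" using D by auto
    moreover have "D \<ge> 0" by (auto simp: D_def intro: prod_nonneg)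
    ultimately have "D > 0" by simp
    have "W \<ge> sqrt (real n) * exp (- real n / 2) * (cmod c * sqrt S)"
    proof (rule power2_le_imp_le)
      have exp_half: "(exp (- (real n / 2)))\<^sup>2 = exp (- real n)"
        by (simp add: power2_eq_square flip: exp_add)
      \<comment> \<open>The factor \<open>n\<close> in place of \<open>n + 1\<close> cancels against the one in the bound on \<open>D\<close>.\<close>
      have "(sqrt (real n) * exp (- real n / 2) * (cmod c * sqrt S))\<^sup>2
          = real n * exp (- real n) * ((cmod c)\<^sup>2 * S)"
        using S by (simp add: power_mult_distrib exp_half)
      also have "\<dots> \<le> real (n + 1) * exp (- real n) * ((cmod c)\<^sup>2 * S)"
        using S by (intro mult_right_mono) auto
      also have "\<dots> \<le> W\<^sup>2"
        unfolding W_def S_def s_def by (rule weyl_norm_ge[OF P c])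
      finally show "(sqrt (real n) * exp (- real n / 2) * (cmod c * sqrt S))\<^sup>2 \<le> W\<^sup>2" .
    qed (auto simp: W_def weyl_norm_def intro!: sum_nonneg)
    hence W_ge: "sqrt (real n) * exp (- real n / 2) * (cmod c * sqrt S) * s i powr (real n / 2 - 1)
        \<le> W * s i powr (real n / 2 - 1)"
      by (intro mult_right_mono) auto
    have "exp (- 3 / 2) * (cmod c * D)
        \<le> exp (- 3 / 2) * (cmod c * (exp ((3 - real n) / 2) * sqrt (real n) * s i powr (real n / 2 - 1) * sqrt S))"
      using le by (intro mult_left_mono) (auto simp: D_def)
    also have "\<dots> = (exp (- 3 / 2) * exp ((3 - real n) / 2))
        * (sqrt (real n) * (cmod c * sqrt S) * s i powr (real n / 2 - 1))"
      by (simp only: mult_ac)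
    also have "exp (- 3 / 2) * exp ((3 - real n) / 2) = exp (- real n / 2)"
      by (simp add: diff_divide_distrib flip: exp_add)
    also have "exp (- real n / 2) * (sqrt (real n) * (cmod c * sqrt S) * s i powr (real n / 2 - 1))
        = sqrt (real n) * exp (- real n / 2) * (cmod c * sqrt S) * s i powr (real n / 2 - 1)"
      by (simp only: mult_ac)
    also note W_ge
    finally have "exp (- 3 / 2) * (cmod c * D) \<le> W * s i powr (real n / 2 - 1)" .
    hence "exp (- 3 / 2) \<le> W * s i powr (real n / 2 - 1) / (cmod c * D)"
      using c \<open>D > 0\<close> by (simp add: pos_le_divide_eq)
    hence "sqrt (real n) * exp (- 3 / 2) \<le> sqrt (real n) * (W * s i powr (real n / 2 - 1) / (cmod c * D))"
      by (intro mult_left_mono) auto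
    thus ?thesis using False by (simp add: mu_norm_at_def D W_def s_def n_def mult.commute)
  qed
  thus ?thesis using root by (auto simp: n_def)
qed

theorem lemma1p1:
  shows "\<exists>C::real. C > 0 \<and>
    (\<forall>(N::nat) (P::complex poly). N \<ge> 1 \<and> degree P = N \<longrightarrow>
       mu_norm P \<ge> ereal (C * sqrt (real N)))"
proof (intro exI[of _ "exp (- 3 / 2)"] conjI allI impI)
  fix N :: nat and P :: "complex poly"
  assume P: "N \<ge> 1 \<and> degree P = N"
  then obtain w where w: "poly P w = 0" "mu_norm_at P w \<ge> ereal (exp (- 3 / 2) * sqrt (real N))"
    using ex_mu_norm_at_ge[of P] by auto
  have "finite {z. poly P z = 0}" using P by (intro poly_roots_finite) auto
  hence "mu_norm_at P w \<le> mu_norm P" unfolding mu_norm_def using w by (intro Max_ge) auto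
  with w show "mu_norm P \<ge> ereal (exp (- 3 / 2) * sqrt (real N))" by (meson order_trans)
qed simp

end
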